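(* Let $p$ be a prime, let $G$ be an abelian group which is a direct sum of cyclic $p$-groups (with an arbitrary, possibly infinite, index set), and let $U\subseteq G$ be a subgroup such that $p(G/U)=0$. Then the pair $(G,U)$ is isomorphic to a direct sum of pickets each of which is of type $P^n_n=(\mathbb Z/(p^n),\mathbb Z/(p^n))$ or $P^n_{n-1}=(\mathbb Z/(p^n),p\mathbb Z/(p^n))$ for some $n\ge 1$. Moreover, this direct sum decomposition is unique up to reordering and isomorphism of the summands.
   Context: A pair $(G,U)$ consists of an abelian group $G$ and a subgroup $U\subseteq G$. A morphism of pairs $(G,U)\to(G',U')$ is a group homomorphism $f:G\to G'$ with $f(U)\subseteq U'$; isomorphisms of pairs are the invertible such morphisms. The direct sum of pairs $(G_i,U_i)_{i\in I}$ is $(\bigoplus_i G_i,\bigoplus_i U_i)$. A picket is a pair $(G,U)$ in which $G$ is a cyclic $p$-group. Note that $P^1_0=(\mathbb Z/(p),0)$. *)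

theory Defs
  imports "HOL-Algebra.Algebra"
begin

text \<open>A pair (G,U): an abelian group G (HOL-Algebra structure) with a subgroup U.
  An isomorphism of pairs is a group isomorphism f with f(U) = V
  (equivalently, f and its inverse are morphisms of pairs).\<close>

definition pair_isomorphic ::
  "('a, 'c) monoid_scheme \<Rightarrow> 'a set \<Rightarrow> ('b, 'd) monoid_scheme \<Rightarrow> 'b set \<Rightarrow> bool" where
  "pair_isomorphic G U H V \<longleftrightarrow> (\<exists>f. f \<in> iso G H \<and> f ` U = V)"

text \<open>The picket P^n_k = (Z/(p^n), p^(n-k) Z/(p^n)); so P^n_n = (Z/(p^n), Z/(p^n)),
  P^n_(n-1) = (Z/(p^n), p Z/(p^n)), P^1_0 = (Z/(p), 0).\<close>

definition picket :: "nat \<Rightarrow> nat \<Rightarrow> nat \<Rightarrow> int monoid \<times> int set" where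
  "picket p n k = (integer_mod_group (p ^ n),
                   {x \<in> carrier (integer_mod_group (p ^ n)). int (p ^ (n - k)) dvd x})"

definition direct_sum_group :: "'i set \<Rightarrow> ('i \<Rightarrow> 'b monoid \<times> 'b set) \<Rightarrow> ('i \<Rightarrow> 'b) monoid" where
  "direct_sum_group I P = sum_group I (\<lambda>i. fst (P i))"

definition direct_sum_sub :: "'i set \<Rightarrow> ('i \<Rightarrow> 'b monoid \<times> 'b set) \<Rightarrow> ('i \<Rightarrow> 'b) set" where
  "direct_sum_sub I P = {x \<in> carrier (direct_sum_group I P). \<forall>i\<in>I. x i \<in> snd (P i)}"

definition picket_decomp ::
  "nat \<Rightarrow> ('a, 'c) monoid_scheme \<Rightarrow> 'a set \<Rightarrow> 'j set \<Rightarrow> ('j \<Rightarrow> nat) \<Rightarrow> ('j \<Rightarrow> nat) \<Rightarrow> bool" where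
  "picket_decomp p G U J n k \<longleftrightarrow>
     (\<forall>j\<in>J. 1 \<le> n j \<and> (k j = n j \<or> k j = n j - 1)) \<and>
     pair_isomorphic G U (direct_sum_group J (\<lambda>j. picket p (n j) (k j)))
                         (direct_sum_sub J (\<lambda>j. picket p (n j) (k j)))"

end

theory Submission
  imports Defs
begin

text \<open>Existence. Take \<open>G = \<Oplus> \<int>/p^(m i)\<close> with generators \<open>e\<^sub>i\<close>, and well-order the indices so that \<open>m\<close> is
  monotone. Let \<open>L\<close> be the set of leading indices of elements of \<open>U\<close> modulo \<open>p\<close>, and replace
  \<open>e\<^sub>i\<close>, for \<open>i \<in> L\<close>, by an element \<open>b\<^sub>i \<in> U\<close> with leading index \<open>i\<close>. Because \<open>m\<close> is
  monotone, \<open>b\<^sub>i\<close> is killed by \<open>p^(m i)\<close>, so \<open>e\<^sub>i \<mapsto> b\<^sub>i\<close> defines an endomorphism; it is triangular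
  with units on the diagonal, hence an automorphism. As \<open>p G \<subseteq> U\<close>, it carries \<open>U\<close> to the sum of the full
  summands for \<open>i \<in> L\<close> and the \<open>p\<close>-multiples for \<open>i \<notin> L\<close>.

  Uniqueness. The chain \<open>(p^N G)[p] \<supseteq> (p^N U)[p] \<supseteq> (p^(N+1) G)[p]\<close> is an invariant of
  the pair, and its successive quotients are vector spaces over \<open>\<int>/p\<close> with one basis vector for each summand
  \<open>P\<^sup>n\<^sub>n\<^sub>-\<^sub>1\<close>, respectively \<open>P\<^sup>n\<^sub>n\<close>, where \<open>n = N + 1\<close>.\<close>

section \<open>Direct sums of cyclic \<open>p\<close>-groups\<close>

definition cyclic_sum :: "nat \<Rightarrow> 'i set \<Rightarrow> ('i \<Rightarrow> nat) \<Rightarrow> ('i \<Rightarrow> int) monoid" where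
  "cyclic_sum p J n = sum_group J (\<lambda>j. integer_mod_group (p ^ n j))"

definition single :: "'i set \<Rightarrow> 'i \<Rightarrow> int \<Rightarrow> 'i \<Rightarrow> int" where
  "single J i c = (\<lambda>j\<in>J. if j = i then c else 0)"

lemma group_cyclic_sum [simp]: "group (cyclic_sum p J n)"
  by (simp add: cyclic_sum_def)

lemma one_cyclic_sum [simp]: "\<one>\<^bsub>cyclic_sum p J n\<^esub> = (\<lambda>j\<in>J. 0)"
  by (simp add: cyclic_sum_def)

lemma mult_cyclic_sum [simp]:
  "x \<otimes>\<^bsub>cyclic_sum p J n\<^esub> y = (\<lambda>j\<in>J. (x j + y j) mod int (p ^ n j))"
  by (auto simp: cyclic_sum_def)

text \<open>With \<open>p > 0\<close> every modulus is positive, so entries are the canonical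
  representatives; modulus \<open>0\<close> would stand for the integers, where no such bounds
  hold.\<close>

lemma carrier_cyclic_sum_iff:
  assumes "p > 0"
  shows "x \<in> carrier (cyclic_sum p J n) \<longleftrightarrow>
    x \<in> extensional J \<and> (\<forall>j\<in>J. 0 \<le> x j \<and> x j < int (p ^ n j)) \<and> finite {j \<in> J. x j \<noteq> 0}"
  using assms
  by (auto simp: cyclic_sum_def carrier_sum_group carrier_integer_mod_group PiE_iff)

lemma inv_cyclic_sum:
  assumes "p > 0" "x \<in> carrier (cyclic_sum p J n)"
  shows "inv\<^bsub>cyclic_sum p J n\<^esub> x = (\<lambda>j\<in>J. (- x j) mod int (p ^ n j))"
proof -
  have "\<And>j. j \<in> J \<Longrightarrow> x j \<in> carrier (integer_mod_group (p ^ n j))"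
    using assms by (auto simp: carrier_cyclic_sum_iff carrier_integer_mod_group)
  then show ?thesis
    using assms(2) by (auto simp: cyclic_sum_def)
qed

lemma pow_cyclic_sum:
  assumes "p > 0" "x \<in> carrier (cyclic_sum p J n)"
  shows "x [^]\<^bsub>cyclic_sum p J n\<^esub> k = (\<lambda>j\<in>J. (int k * x j) mod int (p ^ n j))"
  by (induction k)
     (auto simp: fun_eq_iff mod_add_left_eq mod_add_right_eq algebra_simps simp del: of_nat_power)

lemma single_closed:
  assumes "p > 0" "0 \<le> c" "i \<in> J \<Longrightarrow> c < int (p ^ n i)"
  shows "single J i c \<in> carrier (cyclic_sum p J n)"
proof -
  have "finite {j \<in> J. single J i c j \<noteq> 0}"
    by (rule finite_subset[of _ "{i}"]) (auto simp: single_def)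
  then show ?thesis
    using assms by (auto simp: carrier_cyclic_sum_iff single_def)
qed

lemma cyclic_sum_split:
  assumes "p > 0" "x \<in> carrier (cyclic_sum p J n)"
  shows "(\<lambda>j\<in>J. if j \<in> A then x j else 0) \<in> carrier (cyclic_sum p J n)" (is "?y \<in> _")
    and "(\<lambda>j\<in>J. if j \<in> A then 0 else x j) \<in> carrier (cyclic_sum p J n)" (is "?z \<in> _")
    and "x = (\<lambda>j\<in>J. if j \<in> A then x j else 0) \<otimes>\<^bsub>cyclic_sum p J n\<^esub> (\<lambda>j\<in>J. if j \<in> A then 0 else x j)"
proof -
  have f: "finite {j \<in> J. x j \<noteq> 0}" 
    using assms by (simp add: carrier_cyclic_sum_iff)
  have "finite {j \<in> J. ?y j \<noteq> 0}" "finite {j \<in> J. ?z j \<noteq> 0}"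
    by (rule finite_subset[OF _ f]; auto)+
  then show "?y \<in> carrier (cyclic_sum p J n)" "?z \<in> carrier (cyclic_sum p J n)"
    using assms by (auto simp: carrier_cyclic_sum_iff)
  show "x = ?y \<otimes>\<^bsub>cyclic_sum p J n\<^esub> ?z"
    using assms by (auto simp: carrier_cyclic_sum_iff fun_eq_iff extensional_def)
qed

text \<open>The direct sum is generated by its summands: induction on the size of the support, with
  one coordinate split off at a time. It reduces membership of an element to that of its
  components.\<close>

lemma cyclic_sum_in_subgroup:
  assumes p: "p > 0" and H: "subgroup H (cyclic_sum p J n)"
  shows "x \<in> carrier (cyclic_sum p J n) \<Longrightarrow>
    (\<And>j. j \<in> J \<Longrightarrow> x j \<noteq> 0 \<Longrightarrow> single J j (x j) \<in> H) \<Longrightarrow> x \<in> H"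
proof (induction "card {j \<in> J. x j \<noteq> 0}" arbitrary: x)
  case 0
  then have "{j \<in> J. x j \<noteq> 0} = {}"
    using p by (simp add: carrier_cyclic_sum_iff)
  then have "x = \<one>\<^bsub>cyclic_sum p J n\<^esub>"
    using 0(2) p by (auto simp: carrier_cyclic_sum_iff fun_eq_iff extensional_def)
  then show ?case
    using subgroup.one_closed[OF H] by metis
next
  case (Suc k)
  then obtain i where i: "i \<in> J" "x i \<noteq> 0"
    by (metis (mono_tags, lifting) Collect_empty_eq card.empty nat.distinct(1))
  let ?z = "\<lambda>j\<in>J. if j \<in> {i} then 0 else x j"
  have "{j \<in> J. ?z j \<noteq> 0} = {j \<in> J. x j \<noteq> 0} - {i}"
    by auto
  moreover have "finite {j \<in> J. x j \<noteq> 0}"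
    using Suc.prems(1) p by (simp add: carrier_cyclic_sum_iff)
  ultimately have c: "k = card {j \<in> J. ?z j \<noteq> 0}"
    using Suc.hyps(2) i by simp
  have "?z \<in> H"
    using Suc.hyps(1)[OF c cyclic_sum_split(2)[OF p Suc.prems(1)]] Suc.prems(2)
    by (auto split: if_splits)
  moreover have "(\<lambda>j\<in>J. if j \<in> {i} then x j else 0) = single J i (x i)"
    by (auto simp: single_def)
  ultimately show ?case
    using cyclic_sum_split(3)[OF p Suc.prems(1), of "{i}"] Suc.prems(2)[OF i] subgroup.m_closed[OF H]
    by metis
qed

lemma subgroup_nat_pow_closed:
  fixes k :: nat
  assumes "subgroup H G" "x \<in> H"
  shows "x [^]\<^bsub>G\<^esub> k \<in> H"
  using assms by (induction k) (auto simp: subgroup.one_closed subgroup.m_closed)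

lemma direct_sum_group_picket [simp]:
  "direct_sum_group J (\<lambda>j. picket p (n j) (k j)) = cyclic_sum p J n"
  by (simp add: direct_sum_group_def picket_def cyclic_sum_def)

lemma direct_sum_sub_picket:
  assumes "p > 0"
  shows "direct_sum_sub J (\<lambda>j. picket p (n j) (k j)) =
    {x \<in> carrier (cyclic_sum p J n). \<forall>j\<in>J. int (p ^ (n j - k j)) dvd x j}"
proof -
  have "x j \<in> carrier (integer_mod_group (p ^ n j))"
    if "x \<in> carrier (cyclic_sum p J n)" "j \<in> J" for x j
    using that assms by (auto simp: carrier_cyclic_sum_iff carrier_integer_mod_group)
  then show ?thesis
    unfolding direct_sum_sub_def direct_sum_group_picket by (auto simp: picket_def)
qed

lemma pair_isomorphic_sym:
  assumes "group G" "U \<subseteq> carrier G" "pair_isomorphic G U H V"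
  shows "pair_isomorphic H V G U"
proof -
  obtain f where f: "f \<in> iso G H" "f ` U = V"
    using assms(3) unfolding pair_isomorphic_def by blast
  then have "inj_on f (carrier G)"
    by (simp add: iso_iff)
  then have "inv_into (carrier G) f ` V = U"
    using f(2) assms(2) by (metis inv_into_image_cancel)
  then show ?thesis
    using group.iso_set_sym[OF assms(1) f(1)] unfolding pair_isomorphic_def by blast
qed

lemma pair_isomorphic_trans:
  assumes "pair_isomorphic G U H V" "pair_isomorphic H V K W"
  shows "pair_isomorphic G U K W"
  using assms unfolding pair_isomorphic_def by (metis image_comp iso_set_trans)

section \<open>Existence\<close>

text \<open>Compare \<open>m\<close> first and break ties by an arbitrary well-order of the indices.
  Well-foundedness serves the proof that the new basis generates; monotonicity of \<open>m\<close>
  makes the change of basis a well-defined homomorphism.\<close>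

lemma obtain_graded_well_order:
  fixes m :: "'i \<Rightarrow> nat"
  obtains lt :: "'i \<Rightarrow> 'i \<Rightarrow> bool" where "wfp lt" "transp lt" "totalp lt"
    "\<And>i j. lt i j \<Longrightarrow> m i \<le> m j"
proof -
  obtain r :: "'i rel" where r: "well_order_on UNIV r"
    using well_order_on by blast
  define s where "s = r - Id"
  have wf: "wf s" and tr: "trans s" and tot: "total s"
    using r unfolding s_def well_order_on_def linear_order_on_def partial_order_on_def preorder_on_def
    by (auto intro: trans_diff_Id)
  let ?lt = "\<lambda>i j. (i, j) \<in> inv_image (less_than <*lex*> s) (\<lambda>i. (m i, i))"
  have "wfp ?lt"
    using wf_inv_image[OF wf_lex_prod[OF wf_less_than wf], of "\<lambda>i. (m i, i)"]
    unfolding wfp_wf_eq[symmetric] .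
  moreover have "transp ?lt"
    using tr by (auto simp: transp_def trans_def)
  moreover have "totalp ?lt"
    using tot by (auto simp: totalp_on_def total_on_def)
  moreover have "?lt i j \<Longrightarrow> m i \<le> m j" for i j
    by auto
  ultimately show thesis
    using that by blast
qed

section \<open>Triangular change of basis adapted to the subgroup\<close>

text \<open>The ambient group is already written as a sum of cyclic groups; \<open>pow_U\<close> is
  the hypothesis \<open>p(G/U) = 0\<close>.\<close>

locale triangular_basis =
  fixes p :: nat and I :: "'i set" and m :: "'i \<Rightarrow> nat" and U :: "('i \<Rightarrow> int) set"
    and lt :: "'i \<Rightarrow> 'i \<Rightarrow> bool"
  assumes prime: "Factorial_Ring.prime p"
    and subgroup_U: "subgroup U (cyclic_sum p I m)"
    and pow_U: "x \<in> carrier (cyclic_sum p I m) \<Longrightarrow> x [^]\<^bsub>cyclic_sum p I m\<^esub> p \<in> U"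
    and wfp_lt: "wfp lt" and transp_lt: "transp lt" and totalp_lt: "totalp lt"
    and lt_mono: "lt i j \<Longrightarrow> m i \<le> m j"
begin

abbreviation S where "S \<equiv> cyclic_sum p I m"

lemma p_pos: "p > 0"
  using prime by (simp add: prime_gt_0_nat)

lemma lt_irrefl: "\<not> lt i i"
  using wfp_lt by (meson wfp_imp_irreflp irreflpD)

lemma lt_asym: "lt i j \<Longrightarrow> \<not> lt j i"
  using lt_irrefl transp_lt by (meson transpE)

lemma obtain_max:
  assumes "finite A" "A \<noteq> {}"
  obtains i where "i \<in> A" "\<And>j. j \<in> A \<Longrightarrow> j \<noteq> i \<Longrightarrow> lt j i"
proof -
  have "\<exists>i\<in>A. \<forall>j\<in>A. j \<noteq> i \<longrightarrow> lt j i"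
    using assms
  proof (induction rule: finite_ne_induct)
    case (insert a A)
    then obtain i where i: "i \<in> A" "\<forall>j\<in>A. j \<noteq> i \<longrightarrow> lt j i"
      by blast
    have "lt a i \<or> lt i a"
      using totalp_lt i insert.hyps by (metis UNIV_I totalp_onD)
    then show ?case
      using i transp_lt by (metis insert_iff transpE)
  qed simp
  then show thesis
    using that by blast
qed

text \<open>Exponent \<open>0\<close> gives a trivial summand. Such indices are discarded because a
  picket in the decomposition has \<open>n\<close> at least \<open>1\<close>.\<close>

definition J where "J = {i \<in> I. 1 \<le> m i}"

text \<open>The entry at \<open>i\<close> is prime to \<open>p\<close>, hence a unit modulo
  \<open>p ^ m i\<close>, while the entries above \<open>i\<close> vanish exactly and not only
  modulo \<open>p\<close>. For elements of \<open>U\<close> this loses nothing: entries above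
  \<open>i\<close> that are divisible by \<open>p\<close> can be subtracted inside \<open>U\<close>,
  which contains all multiples of \<open>p\<close>.\<close>

definition lead :: "('i \<Rightarrow> int) \<Rightarrow> 'i \<Rightarrow> bool" where
  "lead u i \<longleftrightarrow> \<not> int p dvd u i \<and> (\<forall>j\<in>I. lt i j \<longrightarrow> u j = 0)"

definition L where "L = {i \<in> J. \<exists>u\<in>U. lead u i}"

definition b where "b i = (if i \<in> L then SOME u. u \<in> U \<and> lead u i else single I i 1)"

abbreviation T where "T \<equiv> cyclic_sum p J m"

text \<open>The linear extension of \<open>single J j 1\<close> \<mapsto> \<open>b j\<close>. The
  sum is restricted to the support of \<open>x\<close>, since over an infinite index set
  \<open>sum\<close> would return the default value \<open>0\<close>.\<close>

definition F where
  "F x = (\<lambda>i\<in>I. (\<Sum>j | j \<in> J \<and> x j \<noteq> 0. x j * b j i) mod int (p ^ m i))"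

text \<open>The subgroup of the picket sum in the form of \<open>direct_sum_sub_picket\<close>: the
  exponent of \<open>p\<close> is \<open>0\<close> for \<open>j\<close> in \<open>L\<close> and
  \<open>1\<close> for the other \<open>j\<close> in \<open>J\<close>.\<close>

abbreviation V where
  "V \<equiv> {x \<in> carrier T. \<forall>j\<in>J. int (p ^ (m j - (if j \<in> L then m j else m j - 1))) dvd x j}"

lemma J_subset: "i \<in> J \<Longrightarrow> i \<in> I"
  by (simp add: J_def)

lemma one_less_pow: "i \<in> J \<Longrightarrow> 1 < int (p ^ m i)"
  using prime_gt_1_nat[OF prime] one_less_power[of p "m i"]
  by (simp add: J_def del: of_nat_power)

lemma U_closed: "u \<in> U \<Longrightarrow> u \<in> carrier S"
  using subgroup.mem_carrier[OF subgroup_U] .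

lemma b_L:
  assumes "i \<in> L"
  shows "b i \<in> U" "lead (b i) i"
proof -
  have "\<exists>u. u \<in> U \<and> lead u i"
    using assms by (auto simp: L_def)
  then have "(SOME u. u \<in> U \<and> lead u i) \<in> U \<and> lead (SOME u. u \<in> U \<and> lead u i) i"
    by (rule someI_ex)
  then show "b i \<in> U" "lead (b i) i"
    using assms by (simp_all add: b_def)
qed

lemma b_closed:
  assumes "i \<in> J"
  shows "b i \<in> carrier S"
proof (cases "i \<in> L")
  case False
  then show ?thesis
    using single_closed[OF p_pos, of 1 i I m] one_less_pow[OF assms] by (simp add: b_def)
qed (simp add: b_L U_closed)

lemma lead_b:
  assumes "i \<in> J"
  shows "lead (b i) i"
proof (cases "i \<in> L")
  case False
  then show ?thesis
    using lt_irrefl assms prime_gt_1_nat[OF prime] by (auto simp: lead_def b_def single_def J_def)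
qed (simp add: b_L)

lemma F_eq:
  assumes "finite A" "{j \<in> J. x j \<noteq> 0} \<subseteq> A" "A \<subseteq> J" "i \<in> I"
  shows "F x i = (\<Sum>j\<in>A. x j * b j i) mod int (p ^ m i)"
proof -
  have "(\<Sum>j | j \<in> J \<and> x j \<noteq> 0. x j * b j i) = (\<Sum>j\<in>A. x j * b j i)"
    using assms by (intro sum.mono_neutral_left) auto
  then show ?thesis
    using assms(4) by (simp add: F_def)
qed

lemma finite_supp: "x \<in> carrier T \<Longrightarrow> finite {j \<in> J. x j \<noteq> 0}"
  using p_pos by (simp add: carrier_cyclic_sum_iff)

lemma F_closed:
  assumes x: "x \<in> carrier T"
  shows "F x \<in> carrier S"
proof -
  have "{i \<in> I. F x i \<noteq> 0} \<subseteq> (\<Union>j\<in>{j \<in> J. x j \<noteq> 0}. {i \<in> I. b j i \<noteq> 0})"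
  proof
    fix i assume i: "i \<in> {i \<in> I. F x i \<noteq> 0}"
    then have "(\<Sum>j | j \<in> J \<and> x j \<noteq> 0. x j * b j i) \<noteq> 0"
      by (auto simp: F_def)
    then obtain j where "j \<in> {j \<in> J. x j \<noteq> 0}" "x j * b j i \<noteq> 0"
      by (rule sum.not_neutral_contains_not_neutral)
    then show "i \<in> (\<Union>j\<in>{j \<in> J. x j \<noteq> 0}. {i \<in> I. b j i \<noteq> 0})"
      using i by auto
  qed
  moreover have "finite (\<Union>j\<in>{j \<in> J. x j \<noteq> 0}. {i \<in> I. b j i \<noteq> 0})"
    using finite_supp[OF x] b_closed p_pos by (simp add: carrier_cyclic_sum_iff)
  ultimately have "finite {i \<in> I. F x i \<noteq> 0}"
    by (rule finite_subset)
  then show ?thesis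
    using p_pos by (auto simp: carrier_cyclic_sum_iff F_def)
qed

text \<open>Addition in \<open>T\<close> reduces the coefficient of \<open>b j\<close> modulo
  \<open>p ^ m j\<close>, so the point is that \<open>b j\<close> is killed by
  \<open>p ^ m j\<close>. This is where monotonicity of \<open>m\<close> along the order
  enters.\<close>

lemma F_mult:
  assumes x: "x \<in> carrier T" and y: "y \<in> carrier T"
  shows "F (x \<otimes>\<^bsub>T\<^esub> y) = F x \<otimes>\<^bsub>S\<^esub> F y"
proof
  fix i
  show "F (x \<otimes>\<^bsub>T\<^esub> y) i = (F x \<otimes>\<^bsub>S\<^esub> F y) i"
  proof (cases "i \<in> I")
    case i: True
    let ?A = "{j \<in> J. x j \<noteq> 0} \<union> {j \<in> J. y j \<noteq> 0}"
    let ?P = "int (p ^ m i)"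
    have fA: "finite ?A"
      using finite_supp x y by simp
    \<comment> \<open>A nonzero entry of \<open>b j\<close> at \<open>i\<close> forces
      \<open>i = j\<close> or \<open>lt i j\<close>, hence \<open>m i\<close> \<le>
      \<open>m j\<close>; reducing first modulo \<open>p ^ m j\<close> is then harmless modulo
      \<open>p ^ m i\<close>.\<close>
    have summand: "((x j + y j) mod int (p ^ m j)) * b j i mod ?P = (x j * b j i + y j * b j i) mod ?P"
      if "j \<in> ?A" for j
    proof (cases "b j i = 0")
      case False
      have "j \<in> J"
        using that by auto
      then have "\<not> lt j i"
        using lead_b[of j] False i by (auto simp: lead_def)
      then have "i = j \<or> lt i j"
        using totalp_lt by (metis UNIV_I totalp_onD)
      then have "?P dvd int (p ^ m j)"
        using lt_mono by (auto simp del: of_nat_power intro: le_imp_power_dvd)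
      then have "((x j + y j) mod int (p ^ m j)) mod ?P = (x j + y j) mod ?P"
        by (rule mod_mod_cancel)
      then show ?thesis
        by (metis distrib_right mod_mult_left_eq)
    qed simp
    have "F (x \<otimes>\<^bsub>T\<^esub> y) i = (\<Sum>j\<in>?A. (x \<otimes>\<^bsub>T\<^esub> y) j * b j i) mod ?P"
      using fA i by (intro F_eq) auto
    also have "\<dots> = (\<Sum>j\<in>?A. ((x j + y j) mod int (p ^ m j)) * b j i) mod ?P"
      by (intro arg_cong[where f = "\<lambda>z. z mod ?P"] sum.cong) auto
    also have "\<dots> = (\<Sum>j\<in>?A. ((x j + y j) mod int (p ^ m j)) * b j i mod ?P) mod ?P"
      by (simp only: mod_sum_eq)
    also have "\<dots> = (\<Sum>j\<in>?A. (x j * b j i + y j * b j i) mod ?P) mod ?P"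
      by (simp only: summand cong: sum.cong)
    also have "\<dots> = ((\<Sum>j\<in>?A. x j * b j i) + (\<Sum>j\<in>?A. y j * b j i)) mod ?P"
      by (simp only: mod_sum_eq sum.distrib)
    also have "\<dots> = ((\<Sum>j\<in>?A. x j * b j i) mod ?P + (\<Sum>j\<in>?A. y j * b j i) mod ?P) mod ?P"
      by (simp only: mod_add_eq)
    also have "\<dots> = (F x i + F y i) mod ?P"
      using F_eq[of ?A x i] F_eq[of ?A y i] fA i by auto
    finally show ?thesis
      using i by simp
  qed (simp add: F_def)
qed

lemma group_hom_F: "group_hom T S F"
  by (auto simp: group_hom_def group_hom_axioms_def hom_def F_closed F_mult simp del: mult_cyclic_sum)

lemma F_single:
  assumes "j \<in> J" "0 \<le> c"
  shows "F (single J j c) = b j [^]\<^bsub>S\<^esub> nat c"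
proof
  fix i
  show "F (single J j c) i = (b j [^]\<^bsub>S\<^esub> nat c) i"
  proof (cases "i \<in> I")
    case True
    moreover have "{l \<in> J. single J j c l \<noteq> 0} \<subseteq> {j}"
      by (auto simp: single_def)
    ultimately show ?thesis
      using F_eq[of "{j}" "single J j c" i] assms b_closed[of j]
      by (simp add: pow_cyclic_sum[OF p_pos] single_def del: of_nat_power pow_nat)
  qed (use b_closed[of j] assms in \<open>simp add: F_def pow_cyclic_sum[OF p_pos] del: pow_nat\<close>)
qed

text \<open>Let \<open>i\<close> be the largest index in the support of a kernel element
  \<open>x\<close>. All other \<open>b j\<close> involved vanish at \<open>i\<close>, so the
  \<open>i\<close>-th entry of \<open>F x\<close> is \<open>x i * b i i\<close>; as
  \<open>b i i\<close> is a unit, \<open>x i\<close> would be \<open>0\<close>.\<close>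

lemma F_inj: "inj_on F (carrier T)"
proof -
  have "x = \<one>\<^bsub>T\<^esub>" if x: "x \<in> carrier T" and F1: "F x = \<one>\<^bsub>S\<^esub>" for x
  proof (rule ccontr)
    assume "x \<noteq> \<one>\<^bsub>T\<^esub>"
    then have "{j \<in> J. x j \<noteq> 0} \<noteq> {}"
      using x p_pos by (auto simp: carrier_cyclic_sum_iff extensional_def fun_eq_iff)
    then obtain i where i: "i \<in> J" "x i \<noteq> 0" and
      mx: "\<And>j. j \<in> J \<Longrightarrow> x j \<noteq> 0 \<Longrightarrow> j \<noteq> i \<Longrightarrow> lt j i"
      using obtain_max[OF finite_supp[OF x]] by (metis (mono_tags, lifting) mem_Collect_eq)
    have "(\<Sum>j | j \<in> J \<and> x j \<noteq> 0. x j * b j i) = (\<Sum>j\<in>{i}. x j * b j i)"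
      using i finite_supp[OF x] lead_b mx J_subset
      by (intro sum.mono_neutral_right) (auto simp: lead_def)
    moreover have "F x i = 0"
      using F1 i J_subset by simp
    ultimately have "int (p ^ m i) dvd x i * b i i"
      using i J_subset by (simp add: F_def mod_eq_0_iff_dvd)
    moreover have "coprime (int (p ^ m i)) (b i i)"
      using lead_b[OF i(1)] prime prime_imp_coprime[of "int p" "b i i"]
      by (simp add: lead_def)
    ultimately have "int (p ^ m i) dvd x i"
      by (metis coprime_dvd_mult_left_iff)
    moreover have "0 \<le> x i" "x i < int (p ^ m i)"
      using x i p_pos by (simp_all add: carrier_cyclic_sum_iff)
    ultimately show False
      using i(2) zdvd_not_zless by fastforce
  qed
  then have "kernel T S F = {\<one>\<^bsub>T\<^esub>}"
    using group_hom.hom_one[OF group_hom_F] group.is_monoid[OF group_cyclic_sum, of p J m]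
    unfolding kernel_def by (blast intro: monoid.one_closed)
  then show ?thesis
    using group_hom.inj_iff_trivial_ker[OF group_hom_F] by blast
qed

lemma subgroup_range_F: "subgroup (F ` carrier T) S"
  using group_hom.img_is_subgroup[OF group_hom_F] .

lemma b_in_range:
  assumes "i \<in> J"
  shows "b i \<in> F ` carrier T"
proof -
  have "F (single J i 1) = b i"
    using F_single[OF assms, of 1] b_closed[OF assms] monoid.nat_pow_eone[OF group.is_monoid[OF group_cyclic_sum]]
    by simp
  moreover have "single J i 1 \<in> carrier T"
    using one_less_pow[OF assms] p_pos by (intro single_closed) auto
  ultimately show ?thesis
    by (metis imageI)
qed

text \<open>Surjectivity on one summand, by well-founded induction on \<open>i\<close>: some
  multiple of \<open>b i\<close> has the entry \<open>c\<close> at \<open>i\<close>, and its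
  remaining entries sit at smaller indices.\<close>

lemma single_in_range:
  assumes "i \<in> I" "0 \<le> c" "c < int (p ^ m i)"
  shows "single I i c \<in> F ` carrier T"
  using wfp_lt assms
proof (induction i arbitrary: c rule: wfp_induct_rule)
  case (less i)
  show ?case
  proof (cases "i \<in> J")
    case False
    then have "single I i c = \<one>\<^bsub>S\<^esub>"
      using less.prems by (cases "m i") (auto simp: J_def single_def fun_eq_iff)
    then show ?thesis
      using subgroup.one_closed[OF subgroup_range_F] by metis
  next
    case i: True
    have "coprime (b i i) (int (p ^ m i))"
      using lead_b[OF i] prime prime_imp_coprime[of "int p" "b i i"]
      by (simp add: lead_def coprime_commute)
    then obtain q r where q: "q * b i i + r * int (p ^ m i) = 1"
      using bezout_int[of "b i i" "int (p ^ m i)"] by (auto simp: coprime_iff_gcd_eq_1)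
    \<comment> \<open>\<open>q\<close> inverts \<open>b i i\<close> modulo \<open>p ^ m i\<close>,
      so the multiple \<open>q * c\<close> of \<open>b i\<close> has entry \<open>c\<close> at
      \<open>i\<close>. Its residue is nonnegative and can be used as a natural exponent.\<close>
    define d where "d = nat (q * c mod int (p ^ m i))"
    have d: "int d = q * c mod int (p ^ m i)"
      using p_pos by (simp add: d_def)
    define v where "v = b i [^]\<^bsub>S\<^esub> d"
    have vR: "v \<in> F ` carrier T"
      unfolding v_def by (rule subgroup_nat_pow_closed[OF subgroup_range_F b_in_range[OF i]])
    have v: "v \<in> carrier S"
      using vR subgroup.mem_carrier[OF subgroup_range_F] by blast
    have v_eq: "v = (\<lambda>j\<in>I. int d * b i j mod int (p ^ m j))"
      unfolding v_def by (rule pow_cyclic_sum[OF p_pos b_closed[OF i]])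
    have "v i = c * (q * b i i) mod int (p ^ m i)"
      using less.prems(1) 
      by (simp add: v_eq d mod_mult_left_eq mult_ac del: of_nat_power) (simp only: mod_mult_right_eq mult_ac)
    also have "q * b i i = 1 - r * int (p ^ m i)"
      using q by simp
    also have "c * (1 - r * int (p ^ m i)) mod int (p ^ m i) = c mod int (p ^ m i)"
      by (simp add: mod_eq_dvd_iff algebra_simps del: of_nat_power)
    finally have vi: "v i = c"
      using less.prems by simp
    let ?w = "\<lambda>j\<in>I. if j \<in> {i} then 0 else v j"
    have wS: "?w \<in> carrier S" and
      v_split: "v = (\<lambda>j\<in>I. if j \<in> {i} then v j else 0) \<otimes>\<^bsub>S\<^esub> ?w"
      using cyclic_sum_split(2,3)[OF p_pos v] by blast+
    \<comment> \<open>The vector \<open>b i\<close> has no entries above \<open>i\<close>, and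
      \<open>?w\<close> has none at \<open>i\<close>, so the induction hypothesis applies to every
      component of \<open>?w\<close>.\<close>
    have "single I j (?w j) \<in> F ` carrier T" if j: "j \<in> I" "?w j \<noteq> 0" for j
    proof -
      have "j \<noteq> i" "b i j \<noteq> 0"
        using j by (auto simp: v_eq split: if_splits)
      then have "lt j i"
        using lead_b[OF i] j(1) totalp_lt unfolding lead_def by (metis UNIV_I totalp_onD)
      then show ?thesis
        using less.IH[of j "?w j"] j(1) wS p_pos by (simp add: carrier_cyclic_sum_iff)
    qed
    then have wR: "?w \<in> F ` carrier T"
      by (rule cyclic_sum_in_subgroup[OF p_pos subgroup_range_F wS])
    have s: "(\<lambda>j\<in>I. if j \<in> {i} then v j else 0) = single I i c"
      using vi by (auto simp: single_def)
    have "single I i c \<in> carrier S"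
      using less.prems p_pos by (intro single_closed) auto
    then have "single I i c = v \<otimes>\<^bsub>S\<^esub> inv\<^bsub>S\<^esub> ?w"
      using group.inv_solve_right[OF group_cyclic_sum _ v wS] v_split unfolding s by blast
    moreover have "v \<otimes>\<^bsub>S\<^esub> inv\<^bsub>S\<^esub> ?w \<in> F ` carrier T"
      using subgroup.m_closed[OF subgroup_range_F vR subgroup.m_inv_closed[OF subgroup_range_F wR]] .
    ultimately show ?thesis
      by argo
  qed
qed

lemma F_iso: "F \<in> iso T S"
proof -
  have "carrier S \<subseteq> F ` carrier T"
    using cyclic_sum_in_subgroup[OF p_pos subgroup_range_F] single_in_range p_pos
    by (auto simp: carrier_cyclic_sum_iff)
  then show ?thesis
    using F_inj F_closed group_hom.homh[OF group_hom_F] by (auto simp: iso_iff)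
qed

text \<open>The preimage of \<open>U\<close> is a subgroup, so it suffices to treat single
  components. For \<open>j\<close> in \<open>L\<close> the vector \<open>b j\<close> lies in
  \<open>U\<close>; otherwise the coefficient is a multiple of \<open>p\<close>, and
  \<open>p\<close>-th powers lie in \<open>U\<close>.\<close>

lemma F_V_subset_U:
  assumes x: "x \<in> V"
  shows "F x \<in> U"
proof -
  interpret F: group_hom T S F
    by (rule group_hom_F)
  have "single J j (x j) \<in> {x \<in> carrier T. F x \<in> U}" if j: "j \<in> J" "x j \<noteq> 0" for j
  proof -
    have xj: "0 \<le> x j" "x j < int (p ^ m j)"
      using x j p_pos by (auto simp: carrier_cyclic_sum_iff)
    then have "single J j (x j) \<in> carrier T"
      using p_pos by (intro single_closed) auto
    moreover have "b j [^]\<^bsub>S\<^esub> nat (x j) \<in> U"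
    proof (cases "j \<in> L")
      case True
      then show ?thesis
        using subgroup_nat_pow_closed[OF subgroup_U] b_L(1) by blast
    next
      case False
      then have "int p dvd x j"
        using x j by (auto simp: J_def)
      then have "nat (x j) = nat (x j) div p * p"
        using xj by (metis dvd_div_mult_self nat_dvd_iff nat_int int_dvd_int_iff zdvd_imp_le int_nat_eq)
      then show ?thesis
        using pow_U[of "b j [^]\<^bsub>S\<^esub> (nat (x j) div p)"] b_closed[OF j(1)]
        by (metis F.H.nat_pow_closed F.H.nat_pow_pow)
    qed
    ultimately show ?thesis
      using F_single[OF j(1) xj(1)] by simp
  qed
  moreover have "subgroup {x \<in> carrier T. F x \<in> U} T"
    using subgroup_U
    by (auto intro!: F.G.subgroupI exI[of _ "\<one>\<^bsub>T\<^esub>"] simp: subgroup.m_closed subgroup.m_inv_closed subgroup.one_closed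
        simp del: one_cyclic_sum mult_cyclic_sum)
  ultimately show ?thesis
    using cyclic_sum_in_subgroup[OF p_pos] x by blast
qed

text \<open>Let \<open>A\<close> be the finite set of indices that violate membership in
  \<open>V\<close>. Removing from \<open>x\<close> the part outside \<open>A\<close>, which lies in
  \<open>V\<close>, leaves an element that \<open>F\<close> still maps into \<open>U\<close>. Its
  image is led by the largest index of \<open>A\<close>, which therefore belongs to
  \<open>L\<close>, against the choice of \<open>A\<close>.\<close>

lemma U_subset_F_V:
  assumes x: "x \<in> carrier T" and U: "F x \<in> U"
  shows "x \<in> V"
proof -
  interpret F: group_hom T S F
    by (rule group_hom_F)
  define A where "A = {j \<in> J - L. \<not> int p dvd x j}"
  have fA: "finite A"
    by (rule finite_subset[OF _ finite_supp[OF x]]) (auto simp: A_def)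
  have "A = {}"
  proof (rule ccontr)
    assume "A \<noteq> {}"
    then obtain i where i: "i \<in> A" and mx: "\<And>j. j \<in> A \<Longrightarrow> j \<noteq> i \<Longrightarrow> lt j i"
      using obtain_max[OF fA] by blast
    define y where "y = (\<lambda>j\<in>J. if j \<in> A then x j else 0)"
    define z where "z = (\<lambda>j\<in>J. if j \<in> A then 0 else x j)"
    note split = cyclic_sum_split[OF p_pos x, of A, folded y_def z_def]
    \<comment> \<open>Subtraction is truncated: the value is \<open>1\<close> only because
      \<open>J\<close> excludes exponent \<open>0\<close>. So outside \<open>L\<close> membership in
      \<open>V\<close> means divisibility by \<open>p\<close>.\<close>
    have "m j - (m j - 1) = 1" if "j \<in> J" for j
      using that by (auto simp: J_def)
    then have "z \<in> V"
      using split(2) by (auto simp: A_def z_def)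
    then have zU: "F z \<in> U"
      by (rule F_V_subset_U)
    have "F x = F y \<otimes>\<^bsub>S\<^esub> F z"
      using arg_cong[OF split(3), of F] F.hom_mult[OF split(1,2)] by (rule trans)
    then have "F y = F x \<otimes>\<^bsub>S\<^esub> inv\<^bsub>S\<^esub> F z"
      using F.H.inv_solve_right[OF F.hom_closed[OF split(1)] F.hom_closed[OF x] F.hom_closed[OF split(2)]]
      by blast
    then have yU: "F y \<in> U"
      using subgroup.m_closed[OF subgroup_U U subgroup.m_inv_closed[OF subgroup_U zU]] by argo
    \<comment> \<open>Outside \<open>L\<close> the basis vectors were left unchanged, so
      \<open>F\<close> fixes the entries of an element supported on \<open>A\<close>.\<close>
    have F_y: "F y j = (if j \<in> A then x j else 0)" if j: "j \<in> I" for j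
    proof -
      have "F y j = (\<Sum>l\<in>A. y l * b l j) mod int (p ^ m j)"
        using fA j by (intro F_eq) (auto simp: A_def y_def)
      also have "(\<Sum>l\<in>A. y l * b l j) = (\<Sum>l\<in>A. if l = j then x j else 0)"
        using j by (intro sum.cong) (auto simp: A_def b_def single_def y_def)
      also have "\<dots> = (if j \<in> A then x j else 0)"
        using fA by simp
      also have "\<dots> mod int (p ^ m j) = (if j \<in> A then x j else 0)"
        using x p_pos by (auto simp: carrier_cyclic_sum_iff A_def)
      finally show ?thesis .
    qed
    have "lead (F y) i"
      using i mx lt_asym lt_irrefl unfolding lead_def by (auto simp: F_y A_def J_def)
    then have "i \<in> L"
      using i yU by (auto simp: L_def A_def)
    then show False
      using i by (simp add: A_def)
  qed
  moreover have "m j - (m j - 1) = 1" if "j \<in> J" for j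
    using that by (auto simp: J_def)
  ultimately show ?thesis
    using x by (auto simp: A_def)
qed

lemma pair_isomorphic_T_V: "pair_isomorphic T V S U"
proof -
  have "F ` V = U"
  proof
    show "F ` V \<subseteq> U"
      using F_V_subset_U by blast
    show "U \<subseteq> F ` V"
    proof
      fix u assume u: "u \<in> U"
      then obtain x where "x \<in> carrier T" "u = F x"
        using F_iso U_closed by (auto simp: iso_iff)
      then show "u \<in> F ` V"
        using u U_subset_F_V by blast
    qed
  qed
  then show ?thesis
    using F_iso unfolding pair_isomorphic_def by blast
qed

end

section \<open>Uniqueness\<close>

text \<open>An element is encoded by its graph over the support, a finite subset of
  \<open>K \<times> {0..<int p}\<close>. An infinite set is equipollent to the family of its finite
  subsets, and the finite factor does not change its cardinality.\<close>

lemma cyclic_sum_lepoll: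
  fixes K :: "'a set"
  assumes "p > 1" "infinite K"
  shows "carrier (cyclic_sum p K (\<lambda>_. 1)) \<lesssim> K"
proof -
  let ?C = "carrier (cyclic_sum p K (\<lambda>_. 1))" and ?B = "{0..<int p}"
  let ?g = "\<lambda>x. (\<lambda>j. (j, x j)) ` {j \<in> K. x j \<noteq> 0}"
  have p: "p > 0"
    using assms by simp
  have "inj_on ?g ?C"
  proof (rule inj_onI)
    fix x y assume x: "x \<in> ?C" and y: "y \<in> ?C" and g: "?g x = ?g y"
    have *: "(j, c) \<in> ?g z \<longleftrightarrow> j \<in> K \<and> z j = c \<and> c \<noteq> 0" for z :: "'a \<Rightarrow> int" and j c
      by auto
    have "x j = y j" if "j \<in> K" for j
      using g *[of j "x j" x] *[of j "x j" y] *[of j "y j" x] *[of j "y j" y] that by metis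
    then show "x = y"
      using x y p by (intro extensionalityI[of x K y]) (simp_all add: carrier_cyclic_sum_iff)
  qed
  moreover have "?g ` ?C \<subseteq> Fpow (K \<times> ?B)"
    using p by (auto simp: Fpow_def carrier_cyclic_sum_iff)
  ultimately have "?C \<lesssim> Fpow (K \<times> ?B)"
    unfolding lepoll_def by blast
  also have "Fpow (K \<times> ?B) \<approx> K \<times> ?B"
  proof (rule eqpoll_Fpow)
    show "infinite (K \<times> ?B)"
      using assms p by (auto simp: finite_cartesian_product_iff)
  qed
  also have "K \<times> ?B \<approx> K"
    unfolding eqpoll_iff_card_of_ordIso
    using assms p
    by (intro card_of_Times_infinite_simps(1) ordLess_imp_ordLeq finite_ordLess_infinite2) auto
  finally show ?thesis .
qed

lemma lepoll_cyclic_sum: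
  assumes "p > 1"
  shows "K \<lesssim> carrier (cyclic_sum p K (\<lambda>_. 1))"
proof -
  have "inj_on (\<lambda>j. single K j 1) K"
  proof (rule inj_onI)
    fix i j assume i: "i \<in> K" and "single K i 1 = single K j 1"
    then have "single K i 1 i = single K j 1 i"
      by simp
    then show "i = j"
      using i by (simp add: single_def split: if_splits)
  qed
  moreover have "(\<lambda>j. single K j 1) ` K \<subseteq> carrier (cyclic_sum p K (\<lambda>_. 1))"
    using assms by (auto intro!: single_closed)
  ultimately show ?thesis
    unfolding lepoll_def by blast
qed

lemma card_cyclic_sum:
  assumes "p > 0" "finite K"
  shows "finite (carrier (cyclic_sum p K (\<lambda>_. 1)))" "card (carrier (cyclic_sum p K (\<lambda>_. 1))) = p ^ card K"
proof -
  have "carrier (cyclic_sum p K (\<lambda>_. 1)) = (\<Pi>\<^sub>E j\<in>K. {0..<int p})"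
    using assms by (simp add: set_eq_iff carrier_cyclic_sum_iff PiE_iff conj_commute)
  then show "finite (carrier (cyclic_sum p K (\<lambda>_. 1)))" "card (carrier (cyclic_sum p K (\<lambda>_. 1))) = p ^ card K"
    using assms by (simp_all add: finite_PiE card_PiE)
qed

text \<open>Over the finite field with \<open>p\<close> elements the dimension is determined by the cardinality
  of the space alone, so no linear algebra is needed.\<close>

lemma eqpoll_if_cyclic_sum_eqpoll:
  assumes p: "p > 1" and eq: "carrier (cyclic_sum p K (\<lambda>_. 1)) \<approx> carrier (cyclic_sum p K' (\<lambda>_. 1))"
  shows "K \<approx> K'"
proof (cases "finite K")
  case True
  have "finite (carrier (cyclic_sum p K' (\<lambda>_. 1)))"
    using card_cyclic_sum(1)[OF _ True, of p] p eqpoll_finite_iff[OF eq] by simp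
  then have K': "finite K'"
    using lepoll_cyclic_sum[OF p, of K'] finite_lepoll_infinite by (meson finite_surj lepoll_iff)
  have "card (carrier (cyclic_sum p K (\<lambda>_. 1))) = card (carrier (cyclic_sum p K' (\<lambda>_. 1)))"
    using eq bij_betw_same_card unfolding eqpoll_def by blast
  then have "p ^ card K = p ^ card K'"
    using card_cyclic_sum(2)[OF _ True, of p] card_cyclic_sum(2)[OF _ K', of p] p by simp
  then show ?thesis
    using p True K' by (simp add: eqpoll_iff_card)
next
  case False
  have "infinite (carrier (cyclic_sum p K (\<lambda>_. 1)))"
    using lepoll_cyclic_sum[OF p, of K] False by (meson finite_surj lepoll_iff)
  then have "infinite (carrier (cyclic_sum p K' (\<lambda>_. 1)))"
    using eqpoll_finite_iff[OF eq] by simp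
  then have K': "infinite K'"
    using card_cyclic_sum(1)[of p K'] p by auto
  have "K \<approx> carrier (cyclic_sum p K (\<lambda>_. 1))"
    by (intro lepoll_antisym cyclic_sum_lepoll lepoll_cyclic_sum p False)
  also note eq
  also have "carrier (cyclic_sum p K' (\<lambda>_. 1)) \<approx> K'"
    by (intro lepoll_antisym cyclic_sum_lepoll lepoll_cyclic_sum p K')
  finally show ?thesis .
qed

text \<open>Both images are copies of the quotient of \<open>Y\<close> by the same equivalence
  relation. This permits comparing quotient groups through maps with prescribed fibres, without
  constructing the quotients.\<close>

lemma image_eqpoll_if_same_fibres:
  assumes "\<And>x y. x \<in> Y \<Longrightarrow> y \<in> Y \<Longrightarrow> g x = g y \<longleftrightarrow> h x = h y"
  shows "g ` Y \<approx> h ` Y"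
proof -
  let ?s = "inv_into Y g"
  have s: "?s (g x) \<in> Y \<and> g (?s (g x)) = g x" if "x \<in> Y" for x
    using that by (simp add: inv_into_into f_inv_into_f)
  have "bij_betw (\<lambda>z. h (?s z)) (g ` Y) (h ` Y)"
    unfolding bij_betw_def
  proof
    show "inj_on (\<lambda>z. h (?s z)) (g ` Y)"
      using s assms by (intro inj_onI) (metis (no_types, lifting) imageE)
    have "h (?s (g x)) = h x" if "x \<in> Y" for x
      using s[OF that] assms that by blast
    then show "(\<lambda>z. h (?s z)) ` g ` Y = h ` Y"
      by (force simp: image_image)
  qed
  then show ?thesis
    unfolding eqpoll_def by blast
qed

section \<open>The socle filtration of a pair\<close>

text \<open>In additive notation this is \<open>(p^N Y)[p]\<close>, the elements of
  \<open>p^N Y\<close> killed by \<open>p\<close>.\<close>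

definition power_socle :: "nat \<Rightarrow> nat \<Rightarrow> ('a, 'c) monoid_scheme \<Rightarrow> 'a set \<Rightarrow> 'a set" where
  "power_socle p N G Y = {x. (\<exists>y\<in>Y. x = y [^]\<^bsub>G\<^esub> (p ^ N)) \<and> x [^]\<^bsub>G\<^esub> p = \<one>\<^bsub>G\<^esub>}"

lemma power_socle_subset:
  assumes "group G" "Y \<subseteq> carrier G"
  shows "power_socle p N G Y \<subseteq> carrier G"
  using assms by (auto simp: power_socle_def group.is_monoid monoid.nat_pow_closed)

lemma power_socle_iso:
  assumes "group G" "group H" "f \<in> iso G H" "Y \<subseteq> carrier G"
  shows "f ` power_socle p N G Y = power_socle p N H (f ` Y)"
proof -
  interpret f: group_hom G H f
    using assms by (simp add: group_hom_def group_hom_axioms_def iso_def)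
  have inj: "inj_on f (carrier G)"
    using assms(3) by (simp add: iso_iff)
  have pow: "f y [^]\<^bsub>H\<^esub> (q::nat) = f (y [^]\<^bsub>G\<^esub> q)" if "y \<in> carrier G" for y q
    using f.hom_nat_pow that by simp
  have "f y [^]\<^bsub>H\<^esub> p = \<one>\<^bsub>H\<^esub> \<longleftrightarrow> y [^]\<^bsub>G\<^esub> p = \<one>\<^bsub>G\<^esub>" if "y \<in> carrier G" for y
    using inj_onD[OF inj, of "y [^]\<^bsub>G\<^esub> p" "\<one>\<^bsub>G\<^esub>"] that by (auto simp: pow)
  moreover have "y \<in> carrier G" if "y \<in> Y" for y
    using that assms(4) by blast
  ultimately show ?thesis
    by (auto simp: power_socle_def pow image_iff)
qed

text \<open>When all \<open>n j\<close> are at least \<open>1\<close>, divisibility of each entry by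
  \<open>p ^ (n j - 1)\<close> says that \<open>x\<close> is killed by \<open>p\<close>; so this is
  the \<open>p\<close>-socle of the partial sum over the indices in \<open>A\<close>.\<close>

definition socle_part :: "nat \<Rightarrow> 'i set \<Rightarrow> ('i \<Rightarrow> nat) \<Rightarrow> 'i set \<Rightarrow> ('i \<Rightarrow> int) set" where
  "socle_part p J n A = {x \<in> carrier (cyclic_sum p J n).
     \<forall>j\<in>J. int (p ^ (n j - 1)) dvd x j \<and> (j \<notin> A \<longrightarrow> x j = 0)}"

text \<open>In one picket, multiplying \<open>p^(n-k) \<int>/(p^n)\<close> by \<open>p^N\<close>
  gives \<open>p^(N+n-k) \<int>/(p^n)\<close>. This is zero for \<open>k\<close> \<le>
  \<open>N\<close>; for \<open>N < k\<close> it contains the whole socle, generated by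
  \<open>p^(n-1)\<close>. The computation is done coordinate by coordinate.\<close>

lemma power_socle_picket_sum:
  assumes p: "p > 0" and nk: "\<forall>j\<in>J. 1 \<le> n j \<and> (k j = n j \<or> k j = n j - 1)"
  shows "power_socle p N (cyclic_sum p J n) (direct_sum_sub J (\<lambda>j. picket p (n j) (k j))) =
    socle_part p J n {j. N < k j}" (is "power_socle p N ?D ?V = ?S")
proof (intro equalityI subsetI)
  note V = direct_sum_sub_picket[OF p, of J n k]
  fix x assume "x \<in> power_socle p N ?D ?V"
  then obtain y where y: "y \<in> ?V" and xy: "x = y [^]\<^bsub>?D\<^esub> (p ^ N)" and px: "x [^]\<^bsub>?D\<^esub> p = \<one>\<^bsub>?D\<^esub>"
    by (auto simp: power_socle_def)
  have yD: "y \<in> carrier ?D"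
    using y V by blast
  then have x: "x \<in> carrier ?D"
    using xy by (simp add: group.is_monoid monoid.nat_pow_closed)
  have x_eq: "x = (\<lambda>j\<in>J. int (p ^ N) * y j mod int (p ^ n j))"
    using pow_cyclic_sum[OF p yD] xy by simp
  have px_eq: "x [^]\<^bsub>?D\<^esub> p = (\<lambda>j\<in>J. int p * x j mod int (p ^ n j))"
    using pow_cyclic_sum[OF p x] by simp
  have "int (p ^ (n j - 1)) dvd x j \<and> (\<not> N < k j \<longrightarrow> x j = 0)" if j: "j \<in> J" for j
  proof
    have n: "p ^ n j = p * p ^ (n j - 1)"
      using nk j by (metis One_nat_def Suc_pred le_eq_less_or_eq less_le_trans zero_less_one power_Suc)
    have "int p * x j mod int (p ^ n j) = 0"
      using fun_cong[OF trans[OF px_eq[symmetric] px], of j] j by simp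
    then have "int p * int (p ^ (n j - 1)) dvd int p * x j"
      unfolding n by (simp add: mod_eq_0_iff_dvd)
    then show "int (p ^ (n j - 1)) dvd x j"
      using p by simp
    show "\<not> N < k j \<longrightarrow> x j = 0"
    proof
      assume "\<not> N < k j"
      then have "int (p ^ n j) dvd int (p ^ (N + (n j - k j)))"
        by (auto intro!: le_imp_power_dvd simp del: of_nat_power)
      moreover have "int (p ^ (N + (n j - k j))) dvd int (p ^ N) * y j"
        using y j V by (auto simp: power_add)
      ultimately show "x j = 0"
        using fun_cong[OF x_eq, of j] j dvd_imp_mod_0[OF dvd_trans] by simp
    qed
  qed
  then show "x \<in> ?S"
    using x by (auto simp: socle_part_def)
next
  note V = direct_sum_sub_picket[OF p, of J n k]
  fix x assume "x \<in> ?S"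
  then have x: "x \<in> carrier ?D" and dv: "\<And>j. j \<in> J \<Longrightarrow> int (p ^ (n j - 1)) dvd x j"
    and z: "\<And>j. j \<in> J \<Longrightarrow> \<not> N < k j \<Longrightarrow> x j = 0"
    by (auto simp: socle_part_def)
  \<comment> \<open>The witness is \<open>x\<close> divided by \<open>p ^ N\<close>. The division is
    exact: if \<open>N < k j\<close>, then \<open>n j - 1\<close> exceeds
    \<open>N + (n j - k j)\<close> by \<open>k j - 1 - N\<close>, so the quotient is even divisible
    by \<open>p ^ (n j - k j)\<close>; otherwise \<open>x j = 0\<close>.\<close>
  define y where "y = (\<lambda>j\<in>J. x j div int (p ^ N))"
  have xD: "0 \<le> x j" "x j < int (p ^ n j)" if "j \<in> J" for j
    using x p that by (auto simp: carrier_cyclic_sum_iff)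
  have "0 \<le> y j \<and> y j < int (p ^ n j)" if j: "j \<in> J" for j
  proof -
    have "x j div int (p ^ N) \<le> x j div 1"
      using xD[OF j] p by (intro zdiv_mono2) auto
    then show ?thesis
      using xD[OF j] p j by (simp add: y_def pos_imp_zdiv_nonneg_iff)
  qed
  moreover have "finite {j \<in> J. y j \<noteq> 0}"
    by (rule finite_subset[of _ "{j \<in> J. x j \<noteq> 0}"])
      (use x p in \<open>auto simp: carrier_cyclic_sum_iff y_def\<close>)
  ultimately have yD: "y \<in> carrier ?D"
    using p by (auto simp: carrier_cyclic_sum_iff y_def)
  have xy: "int (p ^ N) * y j = x j \<and> int (p ^ (n j - k j)) dvd y j" if j: "j \<in> J" for j
  proof (cases "N < k j")
    case True
    obtain c where c: "x j = int (p ^ (n j - 1)) * c"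
      using dv[OF j] by (auto elim: dvdE)
    have "n j - 1 = N + ((n j - k j) + (k j - 1 - N))"
      using nk j True by fastforce
    then have "x j = int (p ^ N) * (int (p ^ (n j - k j)) * (int (p ^ (k j - 1 - N)) * c))"
      using c by (simp only: power_add of_nat_mult mult.assoc)
    then show ?thesis
      using p j by (simp add: y_def)
  qed (use z j in \<open>simp add: y_def\<close>)
  have "y \<in> ?V"
    using yD xy V by auto
  moreover have "x = y [^]\<^bsub>?D\<^esub> (p ^ N)"
    using pow_cyclic_sum[OF p yD, of "p ^ N"] x xy xD p
    by (auto simp: carrier_cyclic_sum_iff fun_eq_iff extensional_def simp del: of_nat_power)
  moreover have "int p * x j mod int (p ^ n j) = 0" if j: "j \<in> J" for j
  proof -
    have n: "p ^ n j = p * p ^ (n j - 1)"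
      using nk j by (metis One_nat_def Suc_pred le_eq_less_or_eq less_le_trans zero_less_one power_Suc)
    show ?thesis
      using dv[OF j] unfolding n by (simp add: mod_eq_0_iff_dvd)
  qed
  then have "x [^]\<^bsub>?D\<^esub> p = \<one>\<^bsub>?D\<^esub>"
    using pow_cyclic_sum[OF p x, of p] by (auto simp: fun_eq_iff simp del: of_nat_power)
  ultimately show "x \<in> power_socle p N ?D ?V"
    by (auto simp: power_socle_def)
qed

lemma power_socle_cyclic_sum:
  assumes p: "p > 0" and n: "\<forall>j\<in>J. 1 \<le> n j"
  shows "power_socle p N (cyclic_sum p J n) (carrier (cyclic_sum p J n)) = socle_part p J n {j. N < n j}"
  using power_socle_picket_sum[OF p, of J n n N] n direct_sum_sub_picket[OF p, of J n n] by simp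

text \<open>On the socle each entry is \<open>p ^ (n j - 1) * c\<close> with \<open>c\<close> in
  \<open>{0..<p}\<close>; the map reads off these coordinates over the field with \<open>p\<close>
  elements, for the indices in \<open>K\<close>.\<close>

definition layer_map :: "nat \<Rightarrow> ('i \<Rightarrow> nat) \<Rightarrow> 'i set \<Rightarrow> ('i \<Rightarrow> int) \<Rightarrow> 'i \<Rightarrow> int" where
  "layer_map p n K x = (\<lambda>j\<in>K. x j div int (p ^ (n j - 1)))"

lemma layer_map_image:
  assumes p: "p > 0" and n: "\<forall>j\<in>J. 1 \<le> n j" and K: "K \<subseteq> J \<inter> A"
  shows "layer_map p n K ` socle_part p J n A = carrier (cyclic_sum p K (\<lambda>_. 1))"
proof -
  have np: "int (p ^ n j) = int p * int (p ^ (n j - 1))" if "j \<in> J" for j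
    using n that by (cases "n j") auto
  show ?thesis
  proof (intro equalityI subsetI)
    fix z assume "z \<in> layer_map p n K ` socle_part p J n A"
    then obtain x where x: "x \<in> socle_part p J n A" and z: "z = layer_map p n K x"
      by blast
    have "{j \<in> K. z j \<noteq> 0} \<subseteq> {j \<in> J. x j \<noteq> 0}"
      using K z by (auto simp: layer_map_def)
    then have "finite {j \<in> K. z j \<noteq> 0}"
      by (rule finite_subset) (use x p in \<open>auto simp: socle_part_def carrier_cyclic_sum_iff\<close>)
    moreover have "0 \<le> z j \<and> z j < int p" if j: "j \<in> K" for j
    proof -
      have j': "j \<in> J"
        using K j by blast
      have pp: "0 < int (p ^ (n j - 1))"
        using p by simp
      have xj: "0 \<le> x j" "x j < int p * int (p ^ (n j - 1))" "int (p ^ (n j - 1)) dvd x j"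
        using x j' p np[OF j'] by (auto simp: socle_part_def carrier_cyclic_sum_iff)
      obtain c where c: "x j = c * int (p ^ (n j - 1))"
        using xj(3) by (metis dvdE mult.commute)
      then have "z j = c"
        using p j by (simp add: z layer_map_def)
      then show ?thesis
        using xj(1,2) p unfolding c by (simp add: zero_le_mult_iff del: of_nat_power)
    qed
    ultimately show "z \<in> carrier (cyclic_sum p K (\<lambda>_. 1))"
      using p z by (auto simp: carrier_cyclic_sum_iff layer_map_def)
  next
    fix z assume z: "z \<in> carrier (cyclic_sum p K (\<lambda>_. 1))"
    define x where "x = (\<lambda>j\<in>J. if j \<in> K then int (p ^ (n j - 1)) * z j else 0)"
    have "{j \<in> J. x j \<noteq> 0} \<subseteq> {j \<in> K. z j \<noteq> 0}"
      by (auto simp: x_def)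
    then have "finite {j \<in> J. x j \<noteq> 0}"
      by (rule finite_subset) (use z p in \<open>auto simp: carrier_cyclic_sum_iff\<close>)
    moreover have "0 \<le> x j \<and> x j < int (p ^ n j)" if j: "j \<in> J" for j
    proof (cases "j \<in> K")
      case True
      then have "0 \<le> z j" "z j < int p"
        using z p by (auto simp: carrier_cyclic_sum_iff)
      then show ?thesis
        using True j p unfolding np[OF j] x_def by (simp add: mult.commute)
    qed (use p j in \<open>simp add: x_def\<close>)
    ultimately have "x \<in> carrier (cyclic_sum p J n)"
      using p by (auto simp: carrier_cyclic_sum_iff x_def)
    then have "x \<in> socle_part p J n A"
      using K by (auto simp: socle_part_def x_def)
    moreover have "z = layer_map p n K x"
      using z p K by (auto simp: layer_map_def x_def carrier_cyclic_sum_iff fun_eq_iff extensional_def)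
    ultimately show "z \<in> layer_map p n K ` socle_part p J n A"
      by blast
  qed
qed

text \<open>The fibres are the cosets of \<open>socle_part p J n B\<close> within
  \<open>socle_part p J n A\<close>: elements of the latter already agree outside \<open>A\<close>,
  so their difference is supported in \<open>B\<close> exactly when they agree on
  \<open>A - B\<close>.\<close>

lemma layer_map_eq_iff:
  assumes p: "p > 0" and x: "x \<in> socle_part p J n A" and y: "y \<in> socle_part p J n A"
  shows "layer_map p n (J \<inter> A - B) x = layer_map p n (J \<inter> A - B) y \<longleftrightarrow>
    x \<otimes>\<^bsub>cyclic_sum p J n\<^esub> inv\<^bsub>cyclic_sum p J n\<^esub> y \<in> socle_part p J n B" (is "?l \<longleftrightarrow> ?w \<in> _")
proof -
  let ?D = "cyclic_sum p J n"
  have xD: "x \<in> carrier ?D" and yD: "y \<in> carrier ?D"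
    using x y by (auto simp: socle_part_def)
  have wD: "?w \<in> carrier ?D"
    using xD yD group_cyclic_sum by (metis group.inv_closed group.is_monoid monoid.m_closed)
  have w: "?w j = (x j - y j) mod int (p ^ n j)" if "j \<in> J" for j
    using that by (simp add: inv_cyclic_sum[OF p yD] mod_add_right_eq del: of_nat_power)
  have dvd: "int (p ^ (n j - 1)) dvd ?w j" if j: "j \<in> J" for j
  proof -
    have "int (p ^ (n j - 1)) dvd int (p ^ n j)"
      by (auto intro: le_imp_power_dvd)
    moreover have "int (p ^ (n j - 1)) dvd x j - y j"
      using x y j by (auto simp: socle_part_def)
    ultimately show ?thesis
      unfolding w[OF j] by (simp only: dvd_mod_iff)
  qed
  have zero: "?w j = 0 \<longleftrightarrow> x j = y j" if j: "j \<in> J" for j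
  proof -
    have "x j mod int (p ^ n j) = x j" "y j mod int (p ^ n j) = y j"
      using xD yD j p by (auto simp: carrier_cyclic_sum_iff)
    then show ?thesis
      unfolding w[OF j] by (metis mod_eq_dvd_iff mod_eq_0_iff_dvd)
  qed
  have "?w \<in> socle_part p J n B \<longleftrightarrow> (\<forall>j\<in>J. j \<notin> B \<longrightarrow> x j = y j)"
    using wD dvd zero unfolding socle_part_def by blast
  also have "\<dots> \<longleftrightarrow> (\<forall>j\<in>J \<inter> A - B. x j = y j)"
    using x y unfolding socle_part_def by fastforce
  also have "\<dots> \<longleftrightarrow> (\<forall>j\<in>J \<inter> A - B. x j div int (p ^ (n j - 1)) = y j div int (p ^ (n j - 1)))"
    using x y by (intro ball_cong refl) (auto simp: socle_part_def dvd_div_eq_iff)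
  also have "\<dots> \<longleftrightarrow> ?l"
    by (auto simp: layer_map_def fun_eq_iff)
  finally show ?thesis
    by blast
qed

text \<open>A quotient-free form of the statement that \<open>Y\<close> modulo \<open>Z\<close> is a
  sum of copies of \<open>\<int>/p\<close> indexed by \<open>J \<inter> A - B\<close>. The fibre
  condition mentions only \<open>G\<close>, \<open>Y\<close> and \<open>Z\<close>, so it does not
  depend on the decomposition \<open>f\<close>.\<close>

lemma layer_map_iso:
  assumes p: "p > 0" and G: "group G" and f: "f \<in> iso G (cyclic_sum p J n)" and n: "\<forall>j\<in>J. 1 \<le> n j"
    and Y: "Y \<subseteq> carrier G" "f ` Y = socle_part p J n A"
    and Z: "Z \<subseteq> carrier G" "f ` Z = socle_part p J n B"
  shows "\<exists>h. h ` Y = carrier (cyclic_sum p (J \<inter> A - B) (\<lambda>_. 1)) \<and>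
    (\<forall>x\<in>Y. \<forall>y\<in>Y. h x = h y \<longleftrightarrow> x \<otimes>\<^bsub>G\<^esub> inv\<^bsub>G\<^esub> y \<in> Z)"
proof -
  let ?D = "cyclic_sum p J n"
  interpret f: group_hom G ?D f
    using f G by (simp add: group_hom_def group_hom_axioms_def iso_def)
  have inj: "inj_on f (carrier G)"
    using f by (simp add: iso_iff)
  let ?h = "\<lambda>x. layer_map p n (J \<inter> A - B) (f x)"
  have "?h ` Y = carrier (cyclic_sum p (J \<inter> A - B) (\<lambda>_. 1))"
    using layer_map_image[OF p n, of "J \<inter> A - B" A] Y(2) by (metis Diff_subset image_image)
  moreover have "?h x = ?h y \<longleftrightarrow> x \<otimes>\<^bsub>G\<^esub> inv\<^bsub>G\<^esub> y \<in> Z" if xy: "x \<in> Y" "y \<in> Y" for x y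
  proof -
    have xyG: "x \<in> carrier G" "y \<in> carrier G"
      using xy Y(1) by auto
    have "?h x = ?h y \<longleftrightarrow> f x \<otimes>\<^bsub>?D\<^esub> inv\<^bsub>?D\<^esub> f y \<in> f ` Z"
      unfolding Z(2) using xy Y(2) by (intro layer_map_eq_iff[OF p]) auto
    also have "f x \<otimes>\<^bsub>?D\<^esub> inv\<^bsub>?D\<^esub> f y = f (x \<otimes>\<^bsub>G\<^esub> inv\<^bsub>G\<^esub> y)"
      using xyG by (metis f.G.inv_closed f.hom_inv f.hom_mult)
    also have "\<dots> \<in> f ` Z \<longleftrightarrow> x \<otimes>\<^bsub>G\<^esub> inv\<^bsub>G\<^esub> y \<in> Z"
      using inj Z(1) xyG by (intro inj_on_image_mem_iff[OF inj]) auto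
    finally show ?thesis .
  qed
  ultimately show ?thesis
    by blast
qed

section \<open>Counting the summands of each type\<close>

lemma picket_decomp_layers:
  assumes p: "p > 0" and G: "group G" and U: "U \<subseteq> carrier G" and dec: "picket_decomp p G U J n k"
  shows "\<exists>h. h ` power_socle p N G (carrier G) = carrier (cyclic_sum p {j \<in> J. n j = Suc N \<and> k j = N} (\<lambda>_. 1)) \<and>
      (\<forall>x\<in>power_socle p N G (carrier G). \<forall>y\<in>power_socle p N G (carrier G).
        h x = h y \<longleftrightarrow> x \<otimes>\<^bsub>G\<^esub> inv\<^bsub>G\<^esub> y \<in> power_socle p N G U)" (is ?thesis1)
    and "\<exists>h. h ` power_socle p N G U = carrier (cyclic_sum p {j \<in> J. n j = Suc N \<and> k j = Suc N} (\<lambda>_. 1)) \<and>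
      (\<forall>x\<in>power_socle p N G U. \<forall>y\<in>power_socle p N G U.
        h x = h y \<longleftrightarrow> x \<otimes>\<^bsub>G\<^esub> inv\<^bsub>G\<^esub> y \<in> power_socle p (Suc N) G (carrier G))" (is ?thesis2)
proof -
  let ?D = "cyclic_sum p J n"
  have nk: "\<forall>j\<in>J. 1 \<le> n j \<and> (k j = n j \<or> k j = n j - 1)"
    using dec by (simp add: picket_decomp_def)
  then have n: "\<forall>j\<in>J. 1 \<le> n j"
    by blast
  obtain f where f: "f \<in> iso G ?D" and fU: "f ` U = direct_sum_sub J (\<lambda>j. picket p (n j) (k j))"
    using dec by (auto simp: picket_decomp_def pair_isomorphic_def)
  have fG: "f ` carrier G = carrier ?D"
    using f by (simp add: iso_iff)
  have f_full: "f ` power_socle p M G (carrier G) = socle_part p J n {j. M < n j}" for M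
    using power_socle_iso[OF G group_cyclic_sum f] power_socle_cyclic_sum[OF p n] fG by simp
  have f_sub: "f ` power_socle p M G U = socle_part p J n {j. M < k j}" for M
    using power_socle_iso[OF G group_cyclic_sum f U] power_socle_picket_sum[OF p nk] fU by simp
  note sub = power_socle_subset[OF G subset_refl] power_socle_subset[OF G U]
  \<comment> \<open>Since \<open>k j\<close> is \<open>n j\<close> or \<open>n j - 1\<close>, the
    inequalities \<open>k j\<close> \<le> \<open>N < n j\<close> leave only
    \<open>n j = N + 1\<close> and \<open>k j = N\<close>.\<close>
  have "J \<inter> {j. N < n j} - {j. N < k j} = {j \<in> J. n j = Suc N \<and> k j = N}"
    using nk by fastforce
  then show ?thesis1
    using layer_map_iso[OF p G f n sub(1) f_full sub(2) f_sub, of N N] by simp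
  \<comment> \<open>Here \<open>N < k j\<close> \<le> \<open>n j\<close> \<le> \<open>N + 1\<close>
    forces equality of \<open>k j\<close>, \<open>n j\<close> and \<open>N + 1\<close>.\<close>
  have "J \<inter> {j. N < k j} - {j. Suc N < n j} = {j \<in> J. n j = Suc N \<and> k j = Suc N}"
    using nk by fastforce
  then show ?thesis2
    using layer_map_iso[OF p G f n sub(2) f_sub sub(1) f_full, of N "Suc N"] by simp
qed

text \<open>Used with \<open>Y\<close> and \<open>R\<close> computed inside the pair itself, hence
  shared by two decompositions, while \<open>K\<close> and \<open>K'\<close> collect their summands
  of one type.\<close>

lemma eqpoll_if_same_layer:
  assumes p: "p > 1"
    and g: "\<exists>g. g ` Y = carrier (cyclic_sum p K (\<lambda>_. 1)) \<and> (\<forall>x\<in>Y. \<forall>y\<in>Y. g x = g y \<longleftrightarrow> R x y)"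
    and h: "\<exists>h. h ` Y = carrier (cyclic_sum p K' (\<lambda>_. 1)) \<and> (\<forall>x\<in>Y. \<forall>y\<in>Y. h x = h y \<longleftrightarrow> R x y)"
  shows "K \<approx> K'"
proof -
  obtain g where g: "g ` Y = carrier (cyclic_sum p K (\<lambda>_. 1))" "\<forall>x\<in>Y. \<forall>y\<in>Y. g x = g y \<longleftrightarrow> R x y"
    using g by blast
  obtain h where h: "h ` Y = carrier (cyclic_sum p K' (\<lambda>_. 1))" "\<forall>x\<in>Y. \<forall>y\<in>Y. h x = h y \<longleftrightarrow> R x y"
    using h by blast
  have "g ` Y \<approx> h ` Y"
    using g(2) h(2) by (intro image_eqpoll_if_same_fibres) simp
  then show ?thesis
    unfolding g(1) h(1) by (rule eqpoll_if_cyclic_sum_eqpoll[OF p])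
qed

text \<open>Types \<open>(N+1, N+1)\<close> and \<open>(N+1, N)\<close> are counted by the two kinds
  of layers; every other type is absent from both decompositions.\<close>

lemma picket_decomp_type_eqpoll:
  assumes p: "p > 1" and G: "group G" and U: "U \<subseteq> carrier G"
    and dec1: "picket_decomp p G U J1 n1 k1" and dec2: "picket_decomp p G U J2 n2 k2"
  shows "{j \<in> J1. n1 j = a \<and> k1 j = c} \<approx> {j \<in> J2. n2 j = a \<and> k2 j = c}"
proof -
  have p0: "p > 0"
    using p by simp
  have nk: "1 \<le> n1 j \<and> (k1 j = n1 j \<or> k1 j = n1 j - 1)" if "j \<in> J1" for j
    using dec1 that by (simp add: picket_decomp_def)
  have nk': "1 \<le> n2 j \<and> (k2 j = n2 j \<or> k2 j = n2 j - 1)" if "j \<in> J2" for j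
    using dec2 that by (simp add: picket_decomp_def)
  consider (full) N where "a = Suc N" "c = Suc N" | (sub) N where "a = Suc N" "c = N"
    | (none) "\<not> (1 \<le> a \<and> (c = a \<or> c = a - 1))"
    by (cases a) auto
  then show ?thesis
  proof cases
    case full
    show ?thesis
      using eqpoll_if_same_layer[OF p picket_decomp_layers(2)[OF p0 G U dec1, of N] picket_decomp_layers(2)[OF p0 G U dec2, of N]]
      unfolding full .
  next
    case sub
    show ?thesis
      using eqpoll_if_same_layer[OF p picket_decomp_layers(1)[OF p0 G U dec1, of N] picket_decomp_layers(1)[OF p0 G U dec2, of N]]
      unfolding sub .
  next
    case none
    then have "{j \<in> J1. n1 j = a \<and> k1 j = c} = {}" "{j \<in> J2. n2 j = a \<and> k2 j = c} = {}"
      using nk nk' by blast+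
    then show ?thesis
      by (simp only: eqpoll_empty_iff_empty)
  qed
qed

text \<open>Bijections chosen for each type glue together, because the fibres partition both index
  sets.\<close>

lemma bij_betw_if_fibres_eqpoll:
  assumes "\<And>t. {j \<in> A. f j = t} \<approx> {j \<in> B. g j = t}"
  shows "\<exists>\<sigma>. bij_betw \<sigma> A B \<and> (\<forall>j\<in>A. g (\<sigma> j) = f j)"
proof -
  obtain s where s: "\<And>t. bij_betw (s t) {j \<in> A. f j = t} {j \<in> B. g j = t}"
    using assms unfolding eqpoll_def by metis
  let ?\<sigma> = "\<lambda>j. s (f j) j"
  have \<sigma>: "?\<sigma> j \<in> B \<and> g (?\<sigma> j) = f j" if "j \<in> A" for j
    using bij_betw_apply[OF s[of "f j"], of j] that by simp
  have "inj_on ?\<sigma> A"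
  proof (rule inj_onI)
    fix i j assume ij: "i \<in> A" "j \<in> A" "?\<sigma> i = ?\<sigma> j"
    then have "f i = f j"
      using \<sigma> by metis
    then show "i = j"
      using inj_onD[OF bij_betw_imp_inj_on[OF s[of "f j"]], of i j] ij by simp
  qed
  moreover have "?\<sigma> ` A = B"
  proof (intro equalityI subsetI)
    fix i assume "i \<in> B"
    then have "i \<in> s (g i) ` {j \<in> A. f j = g i}"
      using bij_betw_imp_surj_on[OF s[of "g i"]] by simp
    then obtain j where "j \<in> A" "f j = g i" "i = s (g i) j"
      by blast
    then show "i \<in> ?\<sigma> ` A"
      by (intro image_eqI[of i ?\<sigma> j]) simp_all
  qed (use \<sigma> in auto)
  ultimately have "bij_betw ?\<sigma> A B"
    unfolding bij_betw_def by (rule conjI)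
  then show ?thesis
    using \<sigma> by (intro exI[of _ ?\<sigma>]) simp
qed

lemma pair_isomorphic_refl: "pair_isomorphic G U G U"
  unfolding pair_isomorphic_def using iso_set_refl by fastforce

theorem theorem1:
  fixes p :: nat and G :: "('a, 'c) monoid_scheme" and U :: "'a set"
    and I :: "'i set" and m :: "'i \<Rightarrow> nat"
  assumes "Factorial_Ring.prime p"
    and "comm_group G"
    and "subgroup U G"
    and "G \<cong> sum_group I (\<lambda>i. integer_mod_group (p ^ m i))"
    and "\<forall>C\<in>carrier (G Mod U). C [^]\<^bsub>G Mod U\<^esub> p = \<one>\<^bsub>G Mod U\<^esub>"
  shows "(\<exists>(J :: 'i set) n k. picket_decomp p G U J n k)
    \<and> (\<forall>(J1 :: 'j set) n1 k1 (J2 :: 'k set) n2 k2.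
          picket_decomp p G U J1 n1 k1 \<and> picket_decomp p G U J2 n2 k2 \<longrightarrow>
          (\<exists>\<sigma>. bij_betw \<sigma> J1 J2 \<and>
               (\<forall>j\<in>J1. pair_isomorphic (fst (picket p (n1 j) (k1 j))) (snd (picket p (n1 j) (k1 j)))
                                        (fst (picket p (n2 (\<sigma> j)) (k2 (\<sigma> j)))) (snd (picket p (n2 (\<sigma> j)) (k2 (\<sigma> j)))))))"
proof (intro conjI allI impI)
  interpret G: comm_group G
    by (rule assms(2))
  interpret U: normal U G
    using G.subgroup_imp_normal[OF assms(3)] .
  let ?S = "cyclic_sum p I m"
  have p: "p > 1"
    using assms(1) by (rule prime_gt_1_nat)
  obtain h where h: "h \<in> iso G ?S"
    using assms(4) by (auto simp: is_iso_def cyclic_sum_def)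
  interpret h: group_hom G ?S h
    using h by (simp add: group_hom_def group_hom_axioms_def iso_def)
  \<comment> \<open>Vanishing of \<open>p(G/U)\<close> says that the coset of \<open>g [^] p\<close>
    is \<open>U\<close>, hence that this power lies in \<open>U\<close>; the statement is
    transported along \<open>h\<close>.\<close>
  have pow: "x [^]\<^bsub>?S\<^esub> p \<in> h ` U" if x: "x \<in> carrier ?S" for x
  proof -
    obtain g where g: "g \<in> carrier G" "x = h g"
      using x h by (auto simp: iso_iff)
    have "U #>\<^bsub>G\<^esub> g [^]\<^bsub>G\<^esub> p = U"
      using assms(5) g(1) U.FactGroup_pow[of g p] by (simp add: carrier_FactGroup)
    then have "g [^]\<^bsub>G\<^esub> p \<in> U"
      using g(1) G.coset_join1[OF _ _ assms(3)] U.subset by blast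
    then show ?thesis
      using h.hom_nat_pow[OF g(1), of p] g(2) by (metis imageI)
  qed
  obtain lt :: "'i \<Rightarrow> 'i \<Rightarrow> bool" where lt: "wfp lt" "transp lt" "totalp lt" "\<And>i j. lt i j \<Longrightarrow> m i \<le> m j"
    using obtain_graded_well_order[of m] by blast
  interpret triangular_basis p I m "h ` U" lt
    by (intro triangular_basis.intro assms(1) h.subgroup_img_is_subgroup[OF assms(3)] pow lt)
  have "pair_isomorphic G U ?S (h ` U)"
    using h by (auto simp: pair_isomorphic_def)
  moreover have "pair_isomorphic ?S (h ` U) T V"
    by (rule pair_isomorphic_sym[OF group_cyclic_sum _ pair_isomorphic_T_V]) blast
  ultimately have "pair_isomorphic G U T V"
    by (rule pair_isomorphic_trans)
  then have "picket_decomp p G U J m (\<lambda>j. if j \<in> L then m j else m j - 1)"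
    unfolding picket_decomp_def direct_sum_group_picket direct_sum_sub_picket[OF p_pos]
    by (simp add: J_def)
  then show "\<exists>(J :: 'i set) n k. picket_decomp p G U J n k"
    by blast
  fix J1 :: "'j set" and n1 k1 and J2 :: "'k set" and n2 k2
  assume dec: "picket_decomp p G U J1 n1 k1 \<and> picket_decomp p G U J2 n2 k2"
  have "{j \<in> J1. (n1 j, k1 j) = t} \<approx> {j \<in> J2. (n2 j, k2 j) = t}" for t
    using picket_decomp_type_eqpoll[OF p G.is_group U.subset, of J1 n1 k1 J2 n2 k2 "fst t" "snd t"] dec
    by (cases t) simp
  then obtain \<sigma> where "bij_betw \<sigma> J1 J2" "\<forall>j\<in>J1. (n2 (\<sigma> j), k2 (\<sigma> j)) = (n1 j, k1 j)"
    using bij_betw_if_fibres_eqpoll[of J1 "\<lambda>j. (n1 j, k1 j)" J2 "\<lambda>j. (n2 j, k2 j)"] by blast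
  \<comment> \<open>The bijection preserves the parameters \<open>(n, k)\<close>, so corresponding
    pickets are equal and reflexivity suffices.\<close>
  then show "\<exists>\<sigma>. bij_betw \<sigma> J1 J2 \<and>
      (\<forall>j\<in>J1. pair_isomorphic (fst (picket p (n1 j) (k1 j))) (snd (picket p (n1 j) (k1 j)))
        (fst (picket p (n2 (\<sigma> j)) (k2 (\<sigma> j)))) (snd (picket p (n2 (\<sigma> j)) (k2 (\<sigma> j)))))"
    using pair_isomorphic_refl by (intro exI[of _ \<sigma>]) auto
qed

end
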